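(* Any coreflection up to retracts is surjective up to retracts, and any reflection up to retracts is surjective up to retracts.
   Context: The idempotent completion $\mathcal{C}^\natural$ of a category $\mathcal{C}$ has as objects the pairs $(X,e)$ with $X$ an object of $\mathcal{C}$ and $e:X\to X$ idempotent; a morphism $f:(X,e)\to(X',e')$ is a morphism $f:X\to X'$ in $\mathcal{C}$ with $f=e'\circ f\circ e$; composition is that of $\mathcal{C}$ and $\mathrm{Id}_{(X,e)}=e$. A functor $F:\mathcal{C}\to\mathcal{D}$ induces its completion $F^\natural:\mathcal{C}^\natural\to\mathcal{D}^\natural$, $F^\natural(X,e)=(FX,Fe)$, $F^\natural(f)=F(f)$. A reflection (resp. coreflection) is a functor admitting a fully faithful right (resp. left) adjoint. A functor $F$ is a reflection (resp. coreflection) up to retracts if $F^\natural$ is a reflection (resp. coreflection). An object $A$ is a retract of an object $B$ if there are morphisms $i:A\to B$, $p:B\to A$ with $p\circ i=\mathrm{Id}_A$. A functor $F:\mathcal{C}\to\mathcal{D}$ is surjective up to retracts if every object $D$ of $\mathcal{D}$ is a retract of $FC$ for some object $C$ of $\mathcal{C}$. *)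

theory Defs
  imports Main
begin

text \<open>
  Hom-sets are indexed by pairs of objects and need not be disjoint: in the idempotent completion
  the same morphism of the base category occurs in many hom-sets. For this reason composition and
  the morphism part of a functor take the objects concerned as arguments:
  \<open>Comp C X Y Z g f\<close> is the composite of \<open>f : X \<rightarrow> Y\<close> and \<open>g : Y \<rightarrow> Z\<close>,
  and \<open>Fmor F X Y f\<close> is the image of \<open>f : X \<rightarrow> Y\<close>. Values at arguments outside the
  carriers are irrelevant.
\<close>

record ('o, 'm) cat =
  Obj :: "'o set"
  Hom :: "'o \<Rightarrow> 'o \<Rightarrow> 'm set"
  Ident :: "'o \<Rightarrow> 'm"
  Comp :: "'o \<Rightarrow> 'o \<Rightarrow> 'o \<Rightarrow> 'm \<Rightarrow> 'm \<Rightarrow> 'm"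

locale category =
  fixes C :: "('o, 'm) cat"
  assumes Ident_in_Hom: "X \<in> Obj C \<Longrightarrow> Ident C X \<in> Hom C X X"
    and Comp_in_Hom:
      "\<lbrakk>X \<in> Obj C; Y \<in> Obj C; Z \<in> Obj C; f \<in> Hom C X Y; g \<in> Hom C Y Z\<rbrakk>
        \<Longrightarrow> Comp C X Y Z g f \<in> Hom C X Z"
    and Comp_Ident_left:
      "\<lbrakk>X \<in> Obj C; Y \<in> Obj C; f \<in> Hom C X Y\<rbrakk> \<Longrightarrow> Comp C X Y Y (Ident C Y) f = f"
    and Comp_Ident_right:
      "\<lbrakk>X \<in> Obj C; Y \<in> Obj C; f \<in> Hom C X Y\<rbrakk> \<Longrightarrow> Comp C X X Y f (Ident C X) = f"
    and Comp_assoc: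
      "\<lbrakk>W \<in> Obj C; X \<in> Obj C; Y \<in> Obj C; Z \<in> Obj C;
        f \<in> Hom C W X; g \<in> Hom C X Y; h \<in> Hom C Y Z\<rbrakk>
        \<Longrightarrow> Comp C W Y Z h (Comp C W X Y g f) = Comp C W X Z (Comp C X Y Z h g) f"

record ('o, 'm, 'p, 'n) fctr =
  Fobj :: "'o \<Rightarrow> 'p"
  Fmor :: "'o \<Rightarrow> 'o \<Rightarrow> 'm \<Rightarrow> 'n"

locale cat_functor = C: category C + D: category D
  for C :: "('o, 'm) cat" and D :: "('p, 'n) cat" +
  fixes F :: "('o, 'm, 'p, 'n) fctr"
  assumes Fobj_in_Obj: "X \<in> Obj C \<Longrightarrow> Fobj F X \<in> Obj D"
    and Fmor_in_Hom:
      "\<lbrakk>X \<in> Obj C; Y \<in> Obj C; f \<in> Hom C X Y\<rbrakk>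
        \<Longrightarrow> Fmor F X Y f \<in> Hom D (Fobj F X) (Fobj F Y)"
    and Fmor_Ident: "X \<in> Obj C \<Longrightarrow> Fmor F X X (Ident C X) = Ident D (Fobj F X)"
    and Fmor_Comp:
      "\<lbrakk>X \<in> Obj C; Y \<in> Obj C; Z \<in> Obj C; f \<in> Hom C X Y; g \<in> Hom C Y Z\<rbrakk>
        \<Longrightarrow> Fmor F X Z (Comp C X Y Z g f) =
            Comp D (Fobj F X) (Fobj F Y) (Fobj F Z) (Fmor F Y Z g) (Fmor F X Y f)"

definition fully_faithful ::
  "('o, 'm) cat \<Rightarrow> ('p, 'n) cat \<Rightarrow> ('o, 'm, 'p, 'n) fctr \<Rightarrow> bool" where
  "fully_faithful C D F \<longleftrightarrow>
    (\<forall>X\<in>Obj C. \<forall>Y\<in>Obj C.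
      bij_betw (Fmor F X Y) (Hom C X Y) (Hom D (Fobj F X) (Fobj F Y)))"

text \<open>
  \<open>adjoint C D L R\<close>: the functor \<open>L : C \<rightarrow> D\<close> is left adjoint to \<open>R : D \<rightarrow> C\<close>, i.e. there are
  bijections \<open>Hom D (L X) Y \<cong> Hom C X (R Y)\<close>, natural in \<open>X\<close> and \<open>Y\<close>.
\<close>

definition adjoint ::
  "('o, 'm) cat \<Rightarrow> ('p, 'n) cat \<Rightarrow> ('o, 'm, 'p, 'n) fctr \<Rightarrow> ('p, 'n, 'o, 'm) fctr \<Rightarrow> bool" where
  "adjoint C D L R \<longleftrightarrow>
    cat_functor C D L \<and> cat_functor D C R \<and>
    (\<exists>\<phi>.
      (\<forall>X\<in>Obj C. \<forall>Y\<in>Obj D.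
        bij_betw (\<phi> X Y) (Hom D (Fobj L X) Y) (Hom C X (Fobj R Y))) \<and>
      (\<forall>X\<in>Obj C. \<forall>X'\<in>Obj C. \<forall>Y\<in>Obj D. \<forall>Y'\<in>Obj D.
        \<forall>h\<in>Hom C X' X. \<forall>k\<in>Hom D Y Y'. \<forall>g\<in>Hom D (Fobj L X) Y.
          \<phi> X' Y' (Comp D (Fobj L X') Y Y' k (Comp D (Fobj L X') (Fobj L X) Y g (Fmor L X' X h))) =
          Comp C X' (Fobj R Y) (Fobj R Y') (Fmor R Y Y' k) (Comp C X' X (Fobj R Y) (\<phi> X Y g) h)))"

definition reflection ::
  "('o, 'm) cat \<Rightarrow> ('p, 'n) cat \<Rightarrow> ('o, 'm, 'p, 'n) fctr \<Rightarrow> bool" where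
  "reflection C D F \<longleftrightarrow> cat_functor C D F \<and> (\<exists>R. adjoint C D F R \<and> fully_faithful D C R)"

definition coreflection ::
  "('o, 'm) cat \<Rightarrow> ('p, 'n) cat \<Rightarrow> ('o, 'm, 'p, 'n) fctr \<Rightarrow> bool" where
  "coreflection C D F \<longleftrightarrow> cat_functor C D F \<and> (\<exists>L. adjoint D C L F \<and> fully_faithful D C L)"

definition idem_completion :: "('o, 'm) cat \<Rightarrow> ('o \<times> 'm, 'm) cat" where
  "idem_completion C =
    \<lparr>Obj = {(X, e). X \<in> Obj C \<and> e \<in> Hom C X X \<and> Comp C X X X e e = e},
     Hom = (\<lambda>(X, e) (X', e'). {f \<in> Hom C X X'. f = Comp C X X' X' e' (Comp C X X X' f e)}),
     Ident = (\<lambda>(X, e). e),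
     Comp = (\<lambda>(X, _) (Y, _) (Z, _). Comp C X Y Z)\<rparr>"

definition functor_completion ::
  "('o, 'm, 'p, 'n) fctr \<Rightarrow> ('o \<times> 'm, 'm, 'p \<times> 'n, 'n) fctr" where
  "functor_completion F =
    \<lparr>Fobj = (\<lambda>(X, e). (Fobj F X, Fmor F X X e)),
     Fmor = (\<lambda>(X, _) (Y, _). Fmor F X Y)\<rparr>"

definition reflection_up_to_retracts ::
  "('o, 'm) cat \<Rightarrow> ('p, 'n) cat \<Rightarrow> ('o, 'm, 'p, 'n) fctr \<Rightarrow> bool" where
  "reflection_up_to_retracts C D F \<longleftrightarrow>
    reflection (idem_completion C) (idem_completion D) (functor_completion F)"

definition coreflection_up_to_retracts ::
  "('o, 'm) cat \<Rightarrow> ('p, 'n) cat \<Rightarrow> ('o, 'm, 'p, 'n) fctr \<Rightarrow> bool" where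
  "coreflection_up_to_retracts C D F \<longleftrightarrow>
    coreflection (idem_completion C) (idem_completion D) (functor_completion F)"

definition retract_of :: "('o, 'm) cat \<Rightarrow> 'o \<Rightarrow> 'o \<Rightarrow> bool" where
  "retract_of C A B \<longleftrightarrow>
    A \<in> Obj C \<and> B \<in> Obj C \<and>
    (\<exists>i\<in>Hom C A B. \<exists>p\<in>Hom C B A. Comp C A B A p i = Ident C A)"

definition surjective_up_to_retracts ::
  "('o, 'm) cat \<Rightarrow> ('p, 'n) cat \<Rightarrow> ('o, 'm, 'p, 'n) fctr \<Rightarrow> bool" where
  "surjective_up_to_retracts C D F \<longleftrightarrow> (\<forall>Y\<in>Obj D. \<exists>X\<in>Obj C. retract_of D Y (Fobj F X))"

lemma (in category) idem_completion_Hom_absorb: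
  assumes "(X, e) \<in> Obj (idem_completion C)" "(Y, d) \<in> Obj (idem_completion C)"
  shows "f \<in> Hom (idem_completion C) (X, e) (Y, d) \<longleftrightarrow>
    f \<in> Hom C X Y \<and> Comp C X Y Y d f = f \<and> Comp C X X Y f e = f"
proof -
  have XY: "X \<in> Obj C" "e \<in> Hom C X X" "Comp C X X X e e = e"
    "Y \<in> Obj C" "d \<in> Hom C Y Y" "Comp C Y Y Y d d = d"
    using assms by (auto simp: idem_completion_def)
  have "Comp C X Y Y d f = f \<and> Comp C X X Y f e = f"
    if f: "f \<in> Hom C X Y" and eq: "f = Comp C X Y Y d (Comp C X X Y f e)"
  proof -
    have fe: "Comp C X X Y f e \<in> Hom C X Y"
      using XY f by (intro Comp_in_Hom)
    have 1: "Comp C X Y Y d f = f"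
      using Comp_assoc[of X Y Y Y "Comp C X X Y f e" d d] XY fe eq by simp
    have "Comp C X X Y f e = Comp C X X Y (Comp C X Y Y d (Comp C X X Y f e)) e"
      using eq by simp
    also have "\<dots> = Comp C X Y Y d (Comp C X X Y (Comp C X X Y f e) e)"
      using Comp_assoc[of X X Y Y e "Comp C X X Y f e" d] XY fe by simp
    also have "Comp C X X Y (Comp C X X Y f e) e = Comp C X X Y f e"
      using Comp_assoc[of X X X Y e e f] XY f by simp
    finally show ?thesis using 1 eq by simp
  qed
  then show ?thesis by (auto simp: idem_completion_def)
qed

lemma category_idem_completion:
  assumes "category C"
  shows "category (idem_completion C)"
proof -
  interpret category C by fact
  have Obj_D: "X \<in> Obj C" "e \<in> Hom C X X" "Comp C X X X e e = e"
    if "(X, e) \<in> Obj (idem_completion C)" for X e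
    using that by (auto simp: idem_completion_def)
  have Comp_eq: "Comp (idem_completion C) (X, e) (Y, d) (Z, c) = Comp C X Y Z" for X e Y d Z c
    by (simp add: idem_completion_def)
  have Ident_eq: "Ident (idem_completion C) (X, e) = e" for X e
    by (simp add: idem_completion_def)
  show ?thesis
  proof (unfold_locales, goal_cases)
    case (1 A)
    then show ?case
      by (cases A) (auto simp: Ident_eq idem_completion_Hom_absorb dest: Obj_D)
  next
    case (2 A B D f g)
    then show ?case
      by (cases A; cases B; cases D)
        (use Obj_D Comp_assoc Comp_in_Hom in
          \<open>auto simp: Comp_eq idem_completion_Hom_absorb; metis\<close>)
  next
    case (3 A B f)
    then show ?case
      by (cases A; cases B) (auto simp: Comp_eq Ident_eq idem_completion_Hom_absorb)
  next
    case (4 A B f)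
    then show ?case
      by (cases A; cases B) (auto simp: Comp_eq Ident_eq idem_completion_Hom_absorb)
  next
    case (5 A B D E f g h)
    then show ?case
      by (cases A; cases B; cases D; cases E)
        (auto simp: Comp_eq idem_completion_Hom_absorb intro!: Comp_assoc dest: Obj_D)
  qed
qed

lemma cat_functor_functor_completion:
  assumes "cat_functor C D F"
  shows "cat_functor (idem_completion C) (idem_completion D) (functor_completion F)"
proof -
  interpret cat_functor C D F by fact
  have Comp_F: "Comp D (Fobj F X) (Fobj F Y) (Fobj F Z) (Fmor F Y Z g) (Fmor F X Y f) =
      Fmor F X Z (Comp C X Y Z g f)"
    if "X \<in> Obj C" "Y \<in> Obj C" "Z \<in> Obj C" "f \<in> Hom C X Y" "g \<in> Hom C Y Z" for X Y Z f g
    using Fmor_Comp[OF that] by simp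
  have Obj_D: "X \<in> Obj C" "e \<in> Hom C X X" "Comp C X X X e e = e"
    if "(X, e) \<in> Obj (idem_completion C)" for X e
    using that by (auto simp: idem_completion_def)
  have Obj_F: "(Fobj F X, Fmor F X X e) \<in> Obj (idem_completion D)"
    if "(X, e) \<in> Obj (idem_completion C)" for X e
    using Obj_D[OF that] by (simp add: idem_completion_def Fobj_in_Obj Fmor_in_Hom Comp_F)
  show ?thesis
  proof (intro cat_functor.intro cat_functor_axioms.intro category_idem_completion, goal_cases)
    case 1 show ?case by (rule C.category_axioms)
  next
    case 2 show ?case by (rule D.category_axioms)
  next
    case (3 A)
    then show ?case by (cases A) (simp add: functor_completion_def Obj_F)
  next
    case (4 A B f)
    obtain X e Y d where AB: "A = (X, e)" "B = (Y, d)" by (cases A; cases B)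
    have X: "X \<in> Obj C" "e \<in> Hom C X X" and Y: "Y \<in> Obj C" "d \<in> Hom C Y Y"
      using 4 AB Obj_D by blast+
    show ?case
      using 4 X Y unfolding AB
      by (simp add: functor_completion_def Obj_F C.idem_completion_Hom_absorb
          D.idem_completion_Hom_absorb Comp_F Fmor_in_Hom)
  next
    case (5 A)
    then show ?case
      by (cases A) (simp add: functor_completion_def idem_completion_def)
  next
    case (6 A B E f g)
    then show ?case
      by (cases A; cases B; cases E)
        (auto simp: functor_completion_def idem_completion_def Comp_F)
  qed
qed

end

(* If F has a fully faithful right adjoint R, the unit at R Y is R s for some s : Y \<rightarrow> F R Y,
   and the triangle identity shows that s is a section of the counit F R Y \<rightarrow> Y, so Y is a retract
   of F R Y. The case of a fully faithful left adjoint is dual. Applied to the completion of F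
   and the object (Y, Id), this exhibits (Y, Id) as a retract of some (F X, F e) in the idempotent
   completion, and the same pair of morphisms exhibits Y as a retract of F X. *)
theory Submission
  imports Defs
begin

text \<open>Transposing identities along the adjunction bijection gives the unit, and transposing
  back gives the counit. Each triangle identity then follows from a single instance of
  naturality.\<close>

lemma adjoint_unit_counit:
  assumes "adjoint C D L R"
  obtains \<eta> \<epsilon> where
    "\<And>X. X \<in> Obj C \<Longrightarrow> \<eta> X \<in> Hom C X (Fobj R (Fobj L X))"
    "\<And>Y. Y \<in> Obj D \<Longrightarrow> \<epsilon> Y \<in> Hom D (Fobj L (Fobj R Y)) Y"
    "\<And>X. X \<in> Obj C \<Longrightarrow>
      Comp D (Fobj L X) (Fobj L (Fobj R (Fobj L X))) (Fobj L X)
        (\<epsilon> (Fobj L X)) (Fmor L X (Fobj R (Fobj L X)) (\<eta> X)) = Ident D (Fobj L X)"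
    "\<And>Y. Y \<in> Obj D \<Longrightarrow>
      Comp C (Fobj R Y) (Fobj R (Fobj L (Fobj R Y))) (Fobj R Y)
        (Fmor R (Fobj L (Fobj R Y)) Y (\<epsilon> Y)) (\<eta> (Fobj R Y)) = Ident C (Fobj R Y)"
proof -
  interpret L: cat_functor C D L using assms by (simp add: adjoint_def)
  interpret R: cat_functor D C R using assms by (simp add: adjoint_def)
  note L_in = L.Fobj_in_Obj and R_in = R.Fobj_in_Obj
  obtain \<phi> where bij: "\<And>X Y. \<lbrakk>X \<in> Obj C; Y \<in> Obj D\<rbrakk> \<Longrightarrow>
      bij_betw (\<phi> X Y) (Hom D (Fobj L X) Y) (Hom C X (Fobj R Y))"
    and nat: "\<And>X X' Y Y' h k g. \<lbrakk>X \<in> Obj C; X' \<in> Obj C; Y \<in> Obj D; Y' \<in> Obj D;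
        h \<in> Hom C X' X; k \<in> Hom D Y Y'; g \<in> Hom D (Fobj L X) Y\<rbrakk> \<Longrightarrow>
      \<phi> X' Y' (Comp D (Fobj L X') Y Y' k (Comp D (Fobj L X') (Fobj L X) Y g (Fmor L X' X h))) =
      Comp C X' (Fobj R Y) (Fobj R Y') (Fmor R Y Y' k) (Comp C X' X (Fobj R Y) (\<phi> X Y g) h)"
    using assms unfolding adjoint_def by blast
  define \<eta> where "\<eta> X = \<phi> X (Fobj L X) (Ident D (Fobj L X))" for X
  define \<epsilon> where
    "\<epsilon> Y = inv_into (Hom D (Fobj L (Fobj R Y)) Y) (\<phi> (Fobj R Y) Y) (Ident C (Fobj R Y))" for Y
  have \<eta>_in: "\<eta> X \<in> Hom C X (Fobj R (Fobj L X))" if "X \<in> Obj C" for X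
    using bij_betwE[OF bij[OF that L_in[OF that]]] that
    by (auto simp: \<eta>_def intro: L.D.Ident_in_Hom L_in)
  have \<epsilon>: "\<epsilon> Y \<in> Hom D (Fobj L (Fobj R Y)) Y" "\<phi> (Fobj R Y) Y (\<epsilon> Y) = Ident C (Fobj R Y)"
    if "Y \<in> Obj D" for Y
  proof -
    have "Ident C (Fobj R Y) \<in> \<phi> (Fobj R Y) Y ` Hom D (Fobj L (Fobj R Y)) Y"
      using bij[OF R_in[OF that] that] that
      by (auto simp: bij_betw_def intro: L.C.Ident_in_Hom R_in)
    then show "\<epsilon> Y \<in> Hom D (Fobj L (Fobj R Y)) Y"
      "\<phi> (Fobj R Y) Y (\<epsilon> Y) = Ident C (Fobj R Y)"
      unfolding \<epsilon>_def by (rule inv_into_into, rule f_inv_into_f)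
  qed
  have tri_L: "Comp D (Fobj L X) (Fobj L (Fobj R (Fobj L X))) (Fobj L X)
        (\<epsilon> (Fobj L X)) (Fmor L X (Fobj R (Fobj L X)) (\<eta> X)) = Ident D (Fobj L X)"
    (is "?l = _") if X: "X \<in> Obj C" for X
  \<comment> \<open>Both sides are endomorphisms of \<open>L X\<close>, so by injectivity of the
    bijection it suffices to compare their transposes.\<close>
  proof (rule inj_onD[OF bij_betw_imp_inj_on[OF bij[OF X L_in[OF X]]]])
    let ?LX = "Fobj L X" and ?RLX = "Fobj R (Fobj L X)"
    have in_Obj: "?LX \<in> Obj D" "?RLX \<in> Obj C" "Fobj L ?RLX \<in> Obj D"
      using X by (simp_all add: L_in R_in)
    show l: "?l \<in> Hom D ?LX ?LX"
      by (intro L.D.Comp_in_Hom L.Fmor_in_Hom \<eta>_in \<epsilon> in_Obj X)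
    show "Ident D ?LX \<in> Hom D ?LX ?LX"
      by (intro L.D.Ident_in_Hom in_Obj)
    \<comment> \<open>Naturality in the first variable along \<open>\<eta> X\<close>, with
      \<open>k\<close> the identity: the counit transposes to the identity, so the right side
      collapses to \<open>\<eta> X\<close>, which is by definition the transpose of the identity of
      \<open>L X\<close>.\<close>
    have "\<phi> X ?LX (Comp D ?LX ?LX ?LX (Ident D ?LX) ?l) =
        Comp C X ?RLX ?RLX (Fmor R ?LX ?LX (Ident D ?LX))
          (Comp C X ?RLX ?RLX (\<phi> ?RLX ?LX (\<epsilon> ?LX)) (\<eta> X))"
      by (intro nat X in_Obj \<eta>_in \<epsilon> L.D.Ident_in_Hom)
    also have "\<dots> = \<eta> X"
      by (simp add: \<epsilon> in_Obj X R.Fmor_Ident L.C.Comp_Ident_left \<eta>_in)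
    finally show "\<phi> X ?LX ?l = \<phi> X ?LX (Ident D ?LX)"
      by (simp add: L.D.Comp_Ident_left in_Obj l flip: \<eta>_def)
  qed
  have tri_R: "Comp C (Fobj R Y) (Fobj R (Fobj L (Fobj R Y))) (Fobj R Y)
        (Fmor R (Fobj L (Fobj R Y)) Y (\<epsilon> Y)) (\<eta> (Fobj R Y)) = Ident C (Fobj R Y)"
    if Y: "Y \<in> Obj D" for Y
  proof -
    let ?RY = "Fobj R Y" and ?LRY = "Fobj L (Fobj R Y)"
    have in_Obj: "?RY \<in> Obj C" "?LRY \<in> Obj D" "Fobj R ?LRY \<in> Obj C"
      using Y by (simp_all add: L_in R_in)
    \<comment> \<open>Naturality in the second variable along \<open>\<epsilon> Y\<close>, with
      \<open>g\<close> and \<open>h\<close> identities: the left side is the transpose of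
      \<open>\<epsilon> Y\<close>, that is the identity of \<open>R Y\<close>, and the right side is
      the composite in question.\<close>
    have "\<phi> ?RY Y (Comp D ?LRY ?LRY Y (\<epsilon> Y)
          (Comp D ?LRY ?LRY ?LRY (Ident D ?LRY) (Fmor L ?RY ?RY (Ident C ?RY)))) =
        Comp C ?RY (Fobj R ?LRY) ?RY (Fmor R ?LRY Y (\<epsilon> Y))
          (Comp C ?RY ?RY (Fobj R ?LRY) (\<phi> ?RY ?LRY (Ident D ?LRY)) (Ident C ?RY))"
      by (intro nat Y in_Obj \<epsilon> L.C.Ident_in_Hom L.D.Ident_in_Hom)
    then show ?thesis
      by (simp add: L.Fmor_Ident L.D.Comp_Ident_left L.D.Comp_Ident_right L.D.Ident_in_Hom
          L.C.Comp_Ident_right \<epsilon> \<eta>_in in_Obj Y flip: \<eta>_def)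
  qed
  show thesis
    by (rule that[OF \<eta>_in \<epsilon>(1) tri_L tri_R])
qed

text \<open>The unit \<open>Y \<rightarrow> F L Y\<close> serves as the section. Its retraction is
  the preimage under \<open>L\<close> of the counit at \<open>L Y\<close>.\<close>

lemma coreflection_imp_surjective_up_to_retracts:
  assumes "coreflection C D F"
  shows "surjective_up_to_retracts C D F"
  unfolding surjective_up_to_retracts_def
proof
  fix Y assume Y: "Y \<in> Obj D"
  obtain L where adj: "adjoint D C L F" and ff: "fully_faithful D C L"
    using assms by (auto simp: coreflection_def)
  interpret L: cat_functor D C L using adj by (simp add: adjoint_def)
  interpret F: cat_functor C D F using adj by (simp add: adjoint_def)
  let ?LY = "Fobj L Y" and ?FLY = "Fobj F (Fobj L Y)"
  have in_Obj: "?LY \<in> Obj C" "?FLY \<in> Obj D"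
    using Y by (simp_all add: L.Fobj_in_Obj F.Fobj_in_Obj)
  \<comment> \<open>Since \<open>F\<close> is the right adjoint here, the unit lives in
    \<open>D\<close> and the counit in \<open>C\<close>; the triangle identity used is the one for
    the left adjoint \<open>L\<close>.\<close>
  obtain i e where i: "i \<in> Hom D Y ?FLY" and e: "e \<in> Hom C (Fobj L ?FLY) ?LY"
    and tri: "Comp C ?LY (Fobj L ?FLY) ?LY e (Fmor L Y ?FLY i) = Ident C ?LY"
    using adjoint_unit_counit[OF adj] Y in_Obj by metis
  \<comment> \<open>Fullness of \<open>L\<close> supplies the retraction \<open>p\<close>;
    faithfulness later cancels \<open>L\<close> from the triangle identity.\<close>
  have "e \<in> Fmor L ?FLY Y ` Hom D ?FLY Y"
    using ff e Y in_Obj by (auto simp: fully_faithful_def bij_betw_def)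
  then obtain p where p: "p \<in> Hom D ?FLY Y" "e = Fmor L ?FLY Y p"
    by blast
  have "Fmor L Y Y (Comp D Y ?FLY Y p i) = Fmor L Y Y (Ident D Y)"
    using tri i p Y in_Obj by (simp add: L.Fmor_Comp L.Fmor_Ident)
  moreover have "inj_on (Fmor L Y Y) (Hom D Y Y)"
    using ff Y by (auto simp: fully_faithful_def bij_betw_def)
  moreover have "Comp D Y ?FLY Y p i \<in> Hom D Y Y" "Ident D Y \<in> Hom D Y Y"
    using i p Y in_Obj by (auto intro: L.C.Comp_in_Hom L.C.Ident_in_Hom)
  ultimately have "Comp D Y ?FLY Y p i = Ident D Y"
    by (auto dest: inj_onD)
  then show "\<exists>X\<in>Obj C. retract_of D Y (Fobj F X)"
    using i p Y in_Obj unfolding retract_of_def by blast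
qed

text \<open>The counit \<open>F R Y \<rightarrow> Y\<close> serves as the retraction, and this time
  the section is what fullness provides, as the preimage under \<open>R\<close> of the unit at
  \<open>R Y\<close>.\<close>

lemma reflection_imp_surjective_up_to_retracts:
  assumes "reflection C D F"
  shows "surjective_up_to_retracts C D F"
  unfolding surjective_up_to_retracts_def
proof
  fix Y assume Y: "Y \<in> Obj D"
  obtain R where adj: "adjoint C D F R" and ff: "fully_faithful D C R"
    using assms by (auto simp: reflection_def)
  interpret F: cat_functor C D F using adj by (simp add: adjoint_def)
  interpret R: cat_functor D C R using adj by (simp add: adjoint_def)
  let ?RY = "Fobj R Y" and ?FRY = "Fobj F (Fobj R Y)"
  have in_Obj: "?RY \<in> Obj C" "?FRY \<in> Obj D"
    using Y by (simp_all add: R.Fobj_in_Obj F.Fobj_in_Obj)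
  obtain u p where u: "u \<in> Hom C ?RY (Fobj R ?FRY)" and p: "p \<in> Hom D ?FRY Y"
    and tri: "Comp C ?RY (Fobj R ?FRY) ?RY (Fmor R ?FRY Y p) u = Ident C ?RY"
    using adjoint_unit_counit[OF adj] Y in_Obj by metis
  have "u \<in> Fmor R Y ?FRY ` Hom D Y ?FRY"
    using ff u Y in_Obj by (auto simp: fully_faithful_def bij_betw_def)
  then obtain i where i: "i \<in> Hom D Y ?FRY" "u = Fmor R Y ?FRY i"
    by blast
  have "Fmor R Y Y (Comp D Y ?FRY Y p i) = Fmor R Y Y (Ident D Y)"
    using tri i p Y in_Obj by (simp add: R.Fmor_Comp R.Fmor_Ident)
  moreover have "inj_on (Fmor R Y Y) (Hom D Y Y)"
    using ff Y by (auto simp: fully_faithful_def bij_betw_def)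
  moreover have "Comp D Y ?FRY Y p i \<in> Hom D Y Y" "Ident D Y \<in> Hom D Y Y"
    using i p Y in_Obj by (auto intro: F.D.Comp_in_Hom F.D.Ident_in_Hom)
  ultimately have "Comp D Y ?FRY Y p i = Ident D Y"
    by (auto dest: inj_onD)
  then show "\<exists>X\<in>Obj C. retract_of D Y (Fobj F X)"
    using i p Y in_Obj unfolding retract_of_def by blast
qed

text \<open>\<open>D\<close> embeds in its completion by pairing each object with its identity, so a
  retraction for \<open>(Y, Ident D Y)\<close> descends to \<open>D\<close> by forgetting the
  idempotents.\<close>

lemma surjective_up_to_retracts_if_completion:
  assumes "cat_functor C D F"
    and "surjective_up_to_retracts (idem_completion C) (idem_completion D) (functor_completion F)"
  shows "surjective_up_to_retracts C D F"
  unfolding surjective_up_to_retracts_def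
proof
  interpret cat_functor C D F by fact
  fix Y assume Y: "Y \<in> Obj D"
  then have "(Y, Ident D Y) \<in> Obj (idem_completion D)"
    by (simp add: idem_completion_def D.Ident_in_Hom D.Comp_Ident_left)
  then obtain X e where Xe: "(X, e) \<in> Obj (idem_completion C)"
    and "retract_of (idem_completion D) (Y, Ident D Y) (Fobj (functor_completion F) (X, e))"
    using assms(2) unfolding surjective_up_to_retracts_def by (metis surj_pair)
  \<comment> \<open>Hom-sets of the completion are subsets of those of \<open>D\<close> with the
    same composition, and the identity of \<open>(Y, Ident D Y)\<close> is \<open>Ident D Y\<close>
    itself.\<close>
  then have "\<exists>i\<in>Hom D Y (Fobj F X). \<exists>p\<in>Hom D (Fobj F X) Y.
      Comp D Y (Fobj F X) Y p i = Ident D Y"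
    by (auto simp: retract_of_def functor_completion_def idem_completion_def)
  moreover have "X \<in> Obj C"
    using Xe by (simp add: idem_completion_def)
  ultimately show "\<exists>X\<in>Obj C. retract_of D Y (Fobj F X)"
    using Y Fobj_in_Obj unfolding retract_of_def by blast
qed

theorem corollary2p19:
  fixes C :: "('o, 'm) cat" and D :: "('p, 'n) cat" and F :: "('o, 'm, 'p, 'n) fctr"
  assumes "category C" and "category D" and "cat_functor C D F"
  shows "(coreflection_up_to_retracts C D F \<longrightarrow> surjective_up_to_retracts C D F) \<and>
         (reflection_up_to_retracts C D F \<longrightarrow> surjective_up_to_retracts C D F)"
  unfolding coreflection_up_to_retracts_def reflection_up_to_retracts_def
  using surjective_up_to_retracts_if_completion[OF assms(3)]
    coreflection_imp_surjective_up_to_retracts reflection_imp_surjective_up_to_retracts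
  by blast

end
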